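(* Let $\mathfrak{F}$ be a saturated formation of finite groups, let $G$ be a finite group and let $U=G^{\mathfrak{F}}$ be the $\mathfrak{F}$-residual of $G$. If $U\cap Z_{\mathfrak{F}}(G)=1$, then $$\left|G/Z_{\mathfrak{F}}(G)\right|\leq\left|\mathrm{Hol}(U)\right|,$$ where $\mathrm{Hol}(U)=U\rtimes\mathrm{Aut}(U)$ is the holomorph of $U$.
   Context: All groups are finite. For a class of groups $\mathfrak{F}$ and a group $G$, the $\mathfrak{F}$-residual $G^{\mathfrak{F}}$ is the intersection of all normal subgroups $N$ of $G$ with $G/N\in\mathfrak{F}$. A non-empty class of groups $\mathfrak{F}$ (closed under isomorphism) is a formation if every homomorphic image of $G/G^{\mathfrak{F}}$ belongs to $\mathfrak{F}$ for every group $G$. A formation $\mathfrak{F}$ is saturated if $G\in\mathfrak{F}$ whenever $G^{\mathfrak{F}}\leq\Phi(G)$ (the Frattini subgroup). Let $R/S$ be a normal section of $G$ (that is, $S\leq R$ and $S,R\trianglelefteq G$). The centraliser $C_G(R/S)$ is the set of $g\in G$ with $g^{-1}rgS=rS$ for all $r\in R$. If $K\trianglelefteq G$ and $K\leq C_G(R/S)$, then $[R/S](G/K)$ denotes the semidirect product of $R/S$ with $G/K$ acting by $(rS)^{gK}=g^{-1}rgS$. The section $R/S$ is $\mathfrak{F}$-central in $G$ if $[R/S](G/K)\in\mathfrak{F}$ for some normal subgroup $K$ of $G$ with $K\leq C_G(R/S)$. The $\mathfrak{F}$-hypercentre $Z_{\mathfrak{F}}(G)$ is the product of all normal subgroups $N$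 of $G$ such that either $N=1$ or $N>1$ and every chief factor of $G$ below $N$ is $\mathfrak{F}$-central in $G$. *)

theory Defs
  imports "HOL-Algebra.Bij" "HOL-Algebra.Generated_Groups"
begin

text \<open>
  Every finite group is isomorphic to one whose elements are natural numbers. An
  isomorphism-closed class of finite groups is therefore given by its members among the groups
  of type \<^typ>\<open>nat monoid\<close>, and a finite group on any other type belongs to the class iff it
  is isomorphic to one of these members. Likewise, it suffices to let the conditions
  defining (saturated) formations range over the groups of type \<^typ>\<open>nat monoid\<close>.
\<close>

definition group_class :: "nat monoid set \<Rightarrow> bool" where
  "group_class \<FF> \<longleftrightarrow>
     (\<forall>H\<in>\<FF>. group H \<and> finite (carrier H)) \<and>
     (\<forall>H\<in>\<FF>. \<forall>K :: nat monoid. group K \<and> H \<cong> K \<longrightarrow> K \<in> \<FF>)"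

definition belongs_to :: "('a, 'b) monoid_scheme \<Rightarrow> nat monoid set \<Rightarrow> bool" where
  "belongs_to G \<FF> \<longleftrightarrow> group G \<and> (\<exists>H\<in>\<FF>. G \<cong> H)"

text \<open>The intersection is taken within \<^term>\<open>G\<close>: an empty family has intersection \<^term>\<open>G\<close>.\<close>

definition residual :: "nat monoid set \<Rightarrow> ('a, 'b) monoid_scheme \<Rightarrow> 'a set" where
  "residual \<FF> G = carrier G \<inter> \<Inter>{N. N \<lhd> G \<and> belongs_to (G Mod N) \<FF>}"

definition formation :: "nat monoid set \<Rightarrow> bool" where
  "formation \<FF> \<longleftrightarrow> group_class \<FF> \<and> \<FF> \<noteq> {} \<and>
     (\<forall>(G :: nat monoid) (H :: nat monoid) f.
        group G \<and> finite (carrier G) \<and> group H \<and> f \<in> epi (G Mod residual \<FF> G) H \<longrightarrow> H \<in> \<FF>)"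

definition maximal_subgroup :: "'a set \<Rightarrow> ('a, 'b) monoid_scheme \<Rightarrow> bool" where
  "maximal_subgroup M G \<longleftrightarrow> subgroup M G \<and> M \<noteq> carrier G \<and>
     (\<forall>H. subgroup H G \<and> M \<subseteq> H \<longrightarrow> H = M \<or> H = carrier G)"

definition frattini :: "('a, 'b) monoid_scheme \<Rightarrow> 'a set" where
  "frattini G = carrier G \<inter> \<Inter>{M. maximal_subgroup M G}"

definition saturated_formation :: "nat monoid set \<Rightarrow> bool" where
  "saturated_formation \<FF> \<longleftrightarrow> formation \<FF> \<and>
     (\<forall>G :: nat monoid. group G \<and> finite (carrier G) \<and> residual \<FF> G \<subseteq> frattini G \<longrightarrow> G \<in> \<FF>)"

text \<open>Semidirect product with normal factor \<^term>\<open>N\<close>, where \<^term>\<open>\<phi>\<close> is a left action of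
  \<^term>\<open>H\<close> on \<^term>\<open>N\<close> by automorphisms.\<close>

definition semidirect ::
  "('a, 'c) monoid_scheme \<Rightarrow> ('b, 'd) monoid_scheme \<Rightarrow> ('b \<Rightarrow> 'a \<Rightarrow> 'a) \<Rightarrow> ('a \<times> 'b) monoid" where
  "semidirect N H \<phi> =
     \<lparr>carrier = carrier N \<times> carrier H,
      mult = (\<lambda>(x, a) (y, b). (x \<otimes>\<^bsub>N\<^esub> \<phi> a y, a \<otimes>\<^bsub>H\<^esub> b)),
      one = (\<one>\<^bsub>N\<^esub>, \<one>\<^bsub>H\<^esub>)\<rparr>"

definition Hol :: "('a, 'b) monoid_scheme \<Rightarrow> ('a \<times> ('a \<Rightarrow> 'a)) monoid" where
  "Hol G = semidirect G (AutoGroup G) (\<lambda>\<alpha>. \<alpha>)"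

definition section_centraliser ::
  "('a, 'b) monoid_scheme \<Rightarrow> 'a set \<Rightarrow> 'a set \<Rightarrow> 'a set" where
  "section_centraliser G R S =
     {g \<in> carrier G. \<forall>r\<in>R. (inv\<^bsub>G\<^esub> g \<otimes>\<^bsub>G\<^esub> r \<otimes>\<^bsub>G\<^esub> g) <#\<^bsub>G\<^esub> S = r <#\<^bsub>G\<^esub> S}"

text \<open>The right action \<open>(r S)\<^sup>g\<^sup>K = g\<^sup>-\<^sup>1 r g S\<close>, for cosets \<open>C = r S\<close> and \<open>A = g K\<close>. When
  \<open>K \<le> C\<^sub>G(R/S)\<close>, all choices of representatives give the same coset, so the union is this
  coset.\<close>

definition section_conj ::
  "('a, 'b) monoid_scheme \<Rightarrow> 'a set \<Rightarrow> 'a set \<Rightarrow> 'a set \<Rightarrow> 'a set" where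
  "section_conj G S C A =
     \<Union>{(inv\<^bsub>G\<^esub> g \<otimes>\<^bsub>G\<^esub> r \<otimes>\<^bsub>G\<^esub> g) <#\<^bsub>G\<^esub> S | r g. r \<in> C \<and> g \<in> A}"

text \<open>The semidirect product \<open>[R/S](G/K)\<close>. The inverse turns the right action above into the
  corresponding left action.\<close>

definition section_semidirect ::
  "('a, 'b) monoid_scheme \<Rightarrow> 'a set \<Rightarrow> 'a set \<Rightarrow> 'a set \<Rightarrow> ('a set \<times> 'a set) monoid" where
  "section_semidirect G R S K =
     semidirect ((G\<lparr>carrier := R\<rparr>) Mod S) (G Mod K)
       (\<lambda>A C. section_conj G S C (inv\<^bsub>G Mod K\<^esub> A))"

definition central_section ::
  "nat monoid set \<Rightarrow> ('a, 'b) monoid_scheme \<Rightarrow> 'a set \<Rightarrow> 'a set \<Rightarrow> bool" where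
  "central_section \<FF> G R S \<longleftrightarrow>
     (\<exists>K. K \<lhd> G \<and> K \<subseteq> section_centraliser G R S \<and> belongs_to (section_semidirect G R S K) \<FF>)"

definition chief_factor :: "('a, 'b) monoid_scheme \<Rightarrow> 'a set \<Rightarrow> 'a set \<Rightarrow> bool" where
  "chief_factor G R S \<longleftrightarrow> R \<lhd> G \<and> S \<lhd> G \<and> S \<subset> R \<and>
     (\<nexists>N. N \<lhd> G \<and> S \<subset> N \<and> N \<subset> R)"

text \<open>The product of a family of normal subgroups is the subgroup generated by their union.\<close>

definition hypercentre :: "nat monoid set \<Rightarrow> ('a, 'b) monoid_scheme \<Rightarrow> 'a set" where
  "hypercentre \<FF> G = generate G
     (\<Union>{N. N \<lhd> G \<and>
            (N = {\<one>\<^bsub>G\<^esub>} \<or>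
             N \<noteq> {\<one>\<^bsub>G\<^esub>} \<and> (\<forall>R S. chief_factor G R S \<and> R \<subseteq> N \<longrightarrow> central_section \<FF> G R S))})"

end

theory Submission
  imports Defs "HOL-Algebra.Zassenhaus"
begin

text \<open>
  Write \<open>U\<close> for the residual and \<open>Z\<close> for the hypercentre of \<open>G\<close>. The proof bounds the index of a
  normal subgroup of \<open>G\<close> that lies inside \<open>Z\<close>.

  Among the subgroups \<open>M\<close> with \<open>G = U M\<close> choose a minimal one. Minimality forces \<open>U \<inter> M\<close> into the
  Frattini subgroup of \<open>M\<close>, while \<open>M/(U \<inter> M)\<close> is isomorphic to \<open>G/U\<close>, which lies in the formation,
  so that the residual of \<open>M\<close> lies in \<open>U \<inter> M\<close>. As the formation is saturated, \<open>M\<close> itself belongs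
  to it (\<open>residual_supplement\<close>).

  The subgroup \<open>C = C\<^sub>M(U)\<close> is normalised by \<open>M\<close> and centralised by \<open>U\<close>, hence normal in
  \<open>G = U M\<close>. Every section \<open>R/S\<close> of \<open>G\<close> with \<open>R \<le> C\<close> is central: as \<open>U\<close> centralises \<open>R\<close>, the product
  \<open>[R/S](G/U)\<close> is defined, and because \<open>G = U M\<close> it is a homomorphic image of the fibre product
  \<open>{(m, n) \<in> M \<times> M. R m = R n}\<close>. This is a subdirect product of two copies of \<open>M\<close>, and a formation
  contains the homomorphic images of subdirect products of its members
  (\<open>formation_subdirect_image\<close>, \<open>section_semidirect_in_formation\<close>). Therefore \<open>C \<le> Z\<close>.

  Finally \<open>|G| \<le> |U| |M|\<close>, and \<open>M/C\<close> embeds into \<open>Aut(U)\<close> by conjugation, so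
  \<open>|G/Z| \<le> |G|/|C| \<le> |U| |M/C| \<le> |U| |Aut(U)| = |Hol(U)|\<close>.
\<close>

section \<open>Formations and groups of arbitrary type\<close>

text \<open>Only groups on natural numbers are constrained by \<^const>\<open>formation\<close>; all other finite groups
  are moved there along such an isomorphism.\<close>

lemma finite_group_nat_copy:
  fixes G :: "('a, 'b) monoid_scheme" (structure)
  assumes "group G" and "finite (carrier G)"
  obtains G' :: "nat monoid" and f where "group G'" "finite (carrier G')" "f \<in> iso G G'"
proof -
  interpret group G by fact
  obtain f :: "'a \<Rightarrow> nat" where f: "inj_on f (carrier G)"
    using assms(2) finite_imp_inj_to_nat_seg by metis
  define g where "g = inv_into (carrier G) f"
  have gf: "g (f x) = x" if "x \<in> carrier G" for x
    using that f by (simp add: g_def)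
  define G' where "G' = \<lparr>carrier = f ` carrier G, mult = (\<lambda>x y. f (g x \<otimes> g y)), one = f \<one>\<rparr>"
  have iso: "f \<in> iso G G'"
    using f gf by (auto simp: iso_iff hom_def G'_def)
  have hom: "f \<in> hom G G'"
    using iso by (rule iso_imp_homomorphism)
  have "group (G'\<lparr>carrier := f ` carrier G, one := f \<one>\<rparr>)"
    using hom_imp_img_group[OF hom] .
  then have "group G'"
    by (simp add: G'_def)
  then show thesis
    using that iso assms(2) by (simp add: G'_def)
qed

lemma belongs_to_iso:
  assumes "belongs_to G \<FF>" and "group H" and "G \<cong> H"
  shows "belongs_to H \<FF>"
  using assms group.iso_sym iso_trans unfolding belongs_to_def by blast

lemma belongs_to_epi_quotient:
  assumes "f \<in> epi G H" and "group G" and "belongs_to H \<FF>"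
  shows "kernel G H f \<lhd> G" and "belongs_to (G Mod kernel G H f) \<FF>"
proof -
  have H: "group H"
    using assms(3) by (simp add: belongs_to_def)
  interpret group_hom G H f
    using assms H by (simp add: group_hom_def group_hom_axioms_def epi_def)
  show *: "kernel G H f \<lhd> G"
    by (rule normal_kernel)
  have "G Mod kernel G H f \<cong> H"
    using FactGroup_iso assms(1) by (simp add: epi_def)
  then have "H \<cong> G Mod kernel G H f"
    using group.iso_sym normal.factorgroup_is_group[OF *] by blast
  then show "belongs_to (G Mod kernel G H f) \<FF>"
    using belongs_to_iso assms(3) normal.factorgroup_is_group[OF *] by blast
qed

lemma residual_subset_kernel:
  assumes "f \<in> epi G H" and "group G" and "belongs_to H \<FF>"
  shows "residual \<FF> G \<subseteq> kernel G H f"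
  using belongs_to_epi_quotient[OF assms] unfolding residual_def by blast

lemma quotient_map_epi:
  assumes "N \<lhd> G"
  shows "(\<lambda>x. N #>\<^bsub>G\<^esub> x) \<in> epi G (G Mod N)"
  using normal.r_coset_hom_Mod[OF assms] by (simp add: epi_def carrier_FactGroup)

lemma quotient_map_eq_one_iff:
  assumes "N \<lhd> G" and "x \<in> carrier G"
  shows "N #>\<^bsub>G\<^esub> x = N \<longleftrightarrow> x \<in> N"
  by (metis assms group.coset_join1 group.coset_join2 normal.axioms(1) normal_def)

lemma residual_normal:
  fixes G (structure)
  assumes "group G"
  shows "residual \<FF> G \<lhd> G"
proof -
  interpret group G by fact
  let ?\<N> = "{N. N \<lhd> G \<and> belongs_to (G Mod N) \<FF>}"
  have sub: "subgroup N G" if "N \<in> ?\<N>" for N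
    using that by (simp add: normal_imp_subgroup)
  show ?thesis
  proof (rule normal_invI)
    show "subgroup (residual \<FF> G) G"
      unfolding residual_def
      by (rule subgroupI)
        (use sub in \<open>auto simp: subgroup.one_closed subgroup.m_closed subgroup.m_inv_closed\<close>)
    show "x \<otimes> h \<otimes> inv x \<in> residual \<FF> G" if "x \<in> carrier G" "h \<in> residual \<FF> G" for x h
      using that normal.inv_op_closed2 unfolding residual_def by fastforce
  qed
qed

text \<open>Quotients of \<open>H\<close> are also quotients of \<open>G\<close>, so the residual of \<open>H\<close> is an intersection of
  fewer kernels.\<close>

lemma residual_epi:
  assumes "f \<in> epi G H" and "group G" and "group H" and "x \<in> residual \<FF> G"
  shows "f x \<in> residual \<FF> H"
proof -
  have x: "x \<in> carrier G"
    using assms(4) by (simp add: residual_def)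
  then have fx: "f x \<in> carrier H"
    using assms(1) by (auto simp: epi_def)
  have "f x \<in> N" if N: "N \<lhd> H" "belongs_to (H Mod N) \<FF>" for N
  proof -
    have "(\<lambda>y. N #>\<^bsub>H\<^esub> y) \<circ> f \<in> epi G (H Mod N)"
      using epi_compose[OF assms(1) quotient_map_epi[OF N(1)]] .
    then have "x \<in> kernel G (H Mod N) ((\<lambda>y. N #>\<^bsub>H\<^esub> y) \<circ> f)"
      using residual_subset_kernel assms(2,4) N(2) by blast
    then show ?thesis
      using quotient_map_eq_one_iff[OF N(1) fx] by (simp add: kernel_def)
  qed
  then show ?thesis
    using fx by (simp add: residual_def)
qed

lemma formation_image:
  assumes "formation \<FF>" and "group G" and "finite (carrier G)" and "group X"
    and f: "f \<in> epi G X" and ker: "residual \<FF> G \<subseteq> kernel G X f"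
  shows "belongs_to X \<FF>"
proof -
  have finX: "finite (carrier X)"
    using f assms(3) by (auto simp: epi_def dest: sym)
  obtain G' :: "nat monoid" and i where G': "group G'" "finite (carrier G')" "i \<in> iso G G'"
    using finite_group_nat_copy assms(2,3) by blast
  obtain X' :: "nat monoid" and k where X': "group X'" "finite (carrier X')" "k \<in> iso X X'"
    using finite_group_nat_copy assms(4) finX by blast
  define j where "j = inv_into (carrier G) i"
  have j: "j \<in> epi G' G"
    using group.iso_set_sym[OF assms(2) G'(3)] by (simp add: j_def iso_iff_mon_epi)
  have k: "k \<in> epi X X'"
    using X'(3) by (simp add: iso_iff_mon_epi)
  define h where "h = k \<circ> (f \<circ> j)"
  have h: "h \<in> epi G' X'"
    unfolding h_def by (intro epi_compose[OF epi_compose[OF j f] k])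
  interpret h: group_hom G' X' h
    using h G' X' by (simp add: group_hom_def group_hom_axioms_def epi_def)
  have ker': "residual \<FF> G' \<subseteq> kernel G' X' h"
  proof
    fix x assume x: "x \<in> residual \<FF> G'"
    then have "f (j x) = \<one>\<^bsub>X\<^esub>"
      using residual_epi[OF j G'(1) assms(2)] ker by (auto simp: kernel_def)
    moreover have "k \<one>\<^bsub>X\<^esub> = \<one>\<^bsub>X'\<^esub>"
      using hom_one k assms(4) X'(1) by (auto simp: epi_def)
    ultimately show "x \<in> kernel G' X' h"
      using x by (simp add: kernel_def h_def residual_def)
  qed
  obtain g where g: "g \<in> hom (G' Mod residual \<FF> G') X'"
    and gh: "\<And>x. x \<in> carrier G' \<Longrightarrow> g (residual \<FF> G' #>\<^bsub>G'\<^esub> x) = h x"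
    using h.FactGroup_universal_kernel[OF residual_normal[OF G'(1)] ker'] by blast
  have "g ` carrier (G' Mod residual \<FF> G') = h ` carrier G'"
    using gh by (auto simp: carrier_FactGroup image_image)
  then have "g \<in> epi (G' Mod residual \<FF> G') X'"
    using g h by (simp add: epi_def)
  then have "X' \<in> \<FF>"
    using assms(1) G' X'(1) unfolding formation_def by blast
  then show ?thesis
    using assms(4) is_isoI[OF X'(3)] by (auto simp: belongs_to_def)
qed

lemma quotient_residual_belongs_to:
  assumes "formation \<FF>" and "group G" and "finite (carrier G)"
  shows "belongs_to (G Mod residual \<FF> G) \<FF>"
proof (rule formation_image[OF assms])
  note N = residual_normal[OF assms(2), of \<FF>]
  show "group (G Mod residual \<FF> G)"
    using normal.factorgroup_is_group[OF N] .
  show "(\<lambda>x. residual \<FF> G #>\<^bsub>G\<^esub> x) \<in> epi G (G Mod residual \<FF> G)"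
    using quotient_map_epi[OF N] .
  show "residual \<FF> G \<subseteq> kernel G (G Mod residual \<FF> G) (\<lambda>x. residual \<FF> G #>\<^bsub>G\<^esub> x)"
    using quotient_map_eq_one_iff[OF N] by (auto simp: kernel_def residual_def)
qed

text \<open>If the kernels of two epimorphisms onto members of the formation meet trivially, then so does
  the family of normal subgroups that defines the residual.\<close>

lemma formation_subdirect_image:
  assumes "formation \<FF>" and "group D" and "finite (carrier D)"
    and "p \<in> epi D A" "belongs_to A \<FF>" and "q \<in> epi D B" "belongs_to B \<FF>"
    and "kernel D A p \<inter> kernel D B q \<subseteq> {\<one>\<^bsub>D\<^esub>}"
    and "group X" and "f \<in> epi D X"
  shows "belongs_to X \<FF>"
proof (rule formation_image[OF assms(1-3,9,10)])
  have "f \<one>\<^bsub>D\<^esub> = \<one>\<^bsub>X\<^esub>"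
    using hom_one assms(2,9,10) by (auto simp: epi_def)
  then have "{\<one>\<^bsub>D\<^esub>} \<subseteq> kernel D X f"
    using assms(2) by (simp add: kernel_def group.is_monoid monoid.one_closed)
  then show "residual \<FF> D \<subseteq> kernel D X f"
    using residual_subset_kernel[OF assms(4,2,5)] residual_subset_kernel[OF assms(6,2,7)] assms(8)
    by blast
qed

lemma iso_maximal_subgroup:
  assumes "f \<in> iso G H" and "group G" and "group H" and "maximal_subgroup M G"
  shows "maximal_subgroup (f ` M) H"
proof -
  have f: "f \<in> hom G H" "f ` carrier G = carrier H" "inj_on f (carrier G)"
    using assms(1) by (auto simp: iso_iff)
  have M: "subgroup M G" "M \<noteq> carrier G" "M \<subseteq> carrier G"
    and max: "\<And>K. subgroup K G \<Longrightarrow> M \<subseteq> K \<Longrightarrow> K = M \<or> K = carrier G"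
    using assms(4) subgroup.subset unfolding maximal_subgroup_def by blast+
  define g where "g = inv_into (carrier G) f"
  have g: "g \<in> iso H G"
    using group.iso_set_sym[OF assms(2,1)] by (simp add: g_def)
  have gf: "g (f x) = x" if "x \<in> carrier G" for x
    using that f(3) by (simp add: g_def)
  have fg: "f (g y) = y" if "y \<in> carrier H" for y
    using that f(2) by (simp add: g_def f_inv_into_f)
  show ?thesis
    unfolding maximal_subgroup_def
  proof (intro conjI allI impI)
    show "subgroup (f ` M) H"
      using subgroup.iso_subgroup[OF M(1) assms(2,3,1)] .
    show "f ` M \<noteq> carrier H"
      using M(2,3) f(2,3) by (metis inj_on_image_eq_iff order_refl)
    fix K assume K: "subgroup K H \<and> f ` M \<subseteq> K"
    then have KH: "K \<subseteq> carrier H"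
      using subgroup.subset by blast
    have "subgroup (g ` K) G"
      using K subgroup.iso_subgroup[OF _ assms(3,2) g] by blast
    moreover have "M \<subseteq> g ` K"
      using K M(3) gf by (metis imageI subsetD subsetI)
    ultimately have "g ` K = M \<or> g ` K = carrier G"
      using max by blast
    moreover have "f ` g ` K = K"
      using fg KH by (force simp: image_image)
    ultimately show "K = f ` M \<or> K = carrier H"
      using f(2) by metis
  qed
qed

lemma saturated_belongs_to:
  assumes "saturated_formation \<FF>" and "group G" and "finite (carrier G)"
    and "residual \<FF> G \<subseteq> frattini G"
  shows "belongs_to G \<FF>"
proof -
  obtain G' :: "nat monoid" and i where G': "group G'" "finite (carrier G')" "i \<in> iso G G'"
    using finite_group_nat_copy assms(2,3) by blast
  define j where "j = inv_into (carrier G) i"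
  have j: "j \<in> iso G' G"
    using group.iso_set_sym[OF assms(2) G'(3)] by (simp add: j_def)
  have "residual \<FF> G' \<subseteq> frattini G'"
  proof
    fix x assume x: "x \<in> residual \<FF> G'"
    then have xc: "x \<in> carrier G'"
      by (simp add: residual_def)
    have "j x \<in> frattini G"
      using residual_epi[OF _ G'(1) assms(2) x] j assms(4) by (auto simp: iso_iff_mon_epi)
    then have "j x \<in> j ` M" if "maximal_subgroup M G'" for M
      using iso_maximal_subgroup[OF j G'(1) assms(2) that] by (simp add: frattini_def)
    then have "x \<in> M" if "maximal_subgroup M G'" for M
      using that j xc inj_on_image_mem_iff[of j "carrier G'" x M] subgroup.subset[of M G']
      by (auto simp: iso_iff maximal_subgroup_def)
    then show "x \<in> frattini G'"
      using xc by (simp add: frattini_def)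
  qed
  then have "G' \<in> \<FF>"
    using assms(1) G' by (simp add: saturated_formation_def)
  then show ?thesis
    using assms(2) is_isoI[OF G'(3)] by (auto simp: belongs_to_def)
qed

section \<open>A supplement of the residual\<close>

text \<open>If a maximal subgroup \<open>L\<close> of a minimal supplement \<open>M\<close> did not contain \<open>N \<inter> M\<close>, then \<open>N L\<close> would
  contain \<open>M\<close>, and \<open>L\<close> would be a smaller supplement.\<close>

lemma (in group) supplement_with_Int_in_frattini:
  assumes "finite (carrier G)" and "N \<lhd> G"
  obtains M where "subgroup M G" "N <#> M = carrier G" "N \<inter> M \<subseteq> frattini (G\<lparr>carrier := M\<rparr>)"
proof -
  have N: "subgroup N G" "N \<subseteq> carrier G"
    using assms(2) normal_imp_subgroup subgroup.subset by blast+
  let ?P = "\<lambda>M. subgroup M G \<and> N <#> M = carrier G"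
  have "N <#> carrier G = carrier G"
  proof
    show "N <#> carrier G \<subseteq> carrier G"
      using N(2) by (simp add: setmult_subset_G)
    show "carrier G \<subseteq> N <#> carrier G"
    proof
      fix x assume "x \<in> carrier G"
      then have "x = \<one> \<otimes> x" "\<one> \<in> N" "x \<in> carrier G"
        using subgroup.one_closed[OF N(1)] by simp_all
      then show "x \<in> N <#> carrier G"
        unfolding set_mult_def by blast
    qed
  qed
  then have "?P (carrier G)"
    using subgroup_self by blast
  then obtain M where M: "?P M" and min: "\<And>L. ?P L \<Longrightarrow> card M \<le> card L"
    using ex_has_least_nat[of ?P "carrier G" card] by blast
  have MG: "M \<subseteq> carrier G"
    using M by (simp add: subgroup.subset)
  then have finM: "finite M"
    using assms(1) by (rule finite_subset)
  have "N \<inter> M \<subseteq> L" if "maximal_subgroup L (G\<lparr>carrier := M\<rparr>)" for L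
  proof -
    have L: "subgroup L (G\<lparr>carrier := M\<rparr>)" "L \<noteq> M"
      and max: "\<And>K. subgroup K (G\<lparr>carrier := M\<rparr>) \<Longrightarrow> L \<subseteq> K \<Longrightarrow> K = L \<or> K = M"
      using that by (auto simp: maximal_subgroup_def)
    have LG: "subgroup L G" and LM: "L \<subseteq> M"
      using incl_subgroup L(1) M subgroup.subset by fastforce+
    have NL: "subgroup (N <#> L) G"
      using mult_norm_subgroup[OF assms(2) LG] .
    have inN: "N \<subseteq> N <#> L"
    proof
      fix x assume x: "x \<in> N"
      then have "x = x \<otimes> \<one>" "\<one> \<in> L"
        using N(2) subgroup.one_closed[OF LG] by auto
      then show "x \<in> N <#> L"
        using x unfolding set_mult_def by blast
    qed
    have inL: "L \<subseteq> N <#> L"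
    proof
      fix x assume x: "x \<in> L"
      then have "x = \<one> \<otimes> x" "\<one> \<in> N"
        using MG LM subgroup.one_closed[OF N(1)] by auto
      then show "x \<in> N <#> L"
        using x unfolding set_mult_def by blast
    qed
    have "subgroup (M \<inter> (N <#> L)) (G\<lparr>carrier := M\<rparr>)"
      using subgroup_incl[OF subgroups_Inter_pair[OF _ NL]] M by blast
    then have "M \<inter> (N <#> L) = L \<or> M \<inter> (N <#> L) = M"
      using max inL LM by blast
    moreover have "M \<inter> (N <#> L) \<noteq> M"
    proof
      assume "M \<inter> (N <#> L) = M"
      then have "M \<subseteq> N <#> L"
        by blast
      then have "N <#> M \<subseteq> N <#> L"
        using inN subgroup.m_closed[OF NL] unfolding set_mult_def[of G N M] by blast
      then have "?P L"
        using M LG subgroup.subset[OF NL] by blast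
      then have "card M \<le> card L"
        by (rule min)
      then show False
        using L(2) LM finM card_seteq by blast
    qed
    ultimately show ?thesis
      using inN by blast
  qed
  then have "N \<inter> M \<subseteq> frattini (G\<lparr>carrier := M\<rparr>)"
    by (auto simp: frattini_def)
  then show thesis
    using that M by blast
qed

lemma (in group) supplement_coset_representative:
  assumes "N \<lhd> G" and "subgroup M G" and "N <#> M = carrier G" and "g \<in> carrier G"
  obtains m where "m \<in> M" "N #> g = N #> m"
proof -
  obtain n m where nm: "n \<in> N" "m \<in> M" "g = n \<otimes> m"
    using assms(3,4) unfolding set_mult_def by blast
  have N: "subgroup N G" "N \<subseteq> carrier G"
    using normal_imp_subgroup[OF assms(1)] by (simp_all add: subgroup.subset)
  have c: "n \<in> carrier G" "m \<in> carrier G"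
    using nm N(2) subgroup.subset[OF assms(2)] by auto
  have "N #> g = (N #> n) #> m"
    using coset_mult_assoc[OF N(2) c] nm(3) by simp
  also have "\<dots> = N #> m"
    using coset_join2[OF c(1) N(1) nm(1)] by simp
  finally show thesis
    using that nm(2) by blast
qed

text \<open>The supplement maps onto \<open>G/U\<close> with kernel \<open>U \<inter> M\<close>.\<close>

lemma residual_supplement:
  fixes G (structure)
  assumes "saturated_formation \<FF>" and "group G" and "finite (carrier G)"
  obtains M where "subgroup M G" "residual \<FF> G <#> M = carrier G"
    "belongs_to (G\<lparr>carrier := M\<rparr>) \<FF>"
proof -
  interpret group G by fact
  define U where "U = residual \<FF> G"
  have U: "U \<lhd> G"
    unfolding U_def by (rule residual_normal[OF assms(2)])
  have quot: "belongs_to (G Mod U) \<FF>"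
    unfolding U_def
    by (rule quotient_residual_belongs_to) (use assms saturated_formation_def in blast)+
  obtain M where M: "subgroup M G" "U <#> M = carrier G"
    and frat: "U \<inter> M \<subseteq> frattini (G\<lparr>carrier := M\<rparr>)"
    using supplement_with_Int_in_frattini[OF assms(3) U] by blast
  have MG: "M \<subseteq> carrier G"
    using M(1) subgroup.subset by blast
  let ?f = "\<lambda>x. U #> x"
  have grp: "group (G\<lparr>carrier := M\<rparr>)"
    using subgroup_imp_group[OF M(1)] .
  have onto: "carrier (G Mod U) \<subseteq> ?f ` M"
  proof
    fix c assume "c \<in> carrier (G Mod U)"
    then obtain g where g: "g \<in> carrier G" "c = U #> g"
      by (auto simp: carrier_FactGroup)
    then obtain m where "m \<in> M" "U #> g = U #> m"
      using supplement_coset_representative[OF U M] by blast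
    then show "c \<in> ?f ` M"
      using g(2) by blast
  qed
  have "?f \<in> epi (G\<lparr>carrier := M\<rparr>) (G Mod U)"
    using onto normal.r_coset_hom_Mod[OF U] MG by (simp add: epi_iff_subset hom_def Pi_iff subset_iff)
  then have "residual \<FF> (G\<lparr>carrier := M\<rparr>) \<subseteq> kernel (G\<lparr>carrier := M\<rparr>) (G Mod U) ?f"
    using residual_subset_kernel grp quot by blast
  also have "\<dots> \<subseteq> U \<inter> M"
    using quotient_map_eq_one_iff[OF U] MG by (auto simp: kernel_def)
  finally have "residual \<FF> (G\<lparr>carrier := M\<rparr>) \<subseteq> frattini (G\<lparr>carrier := M\<rparr>)"
    using frat by blast
  then have "belongs_to (G\<lparr>carrier := M\<rparr>) \<FF>"
    using saturated_belongs_to[OF assms(1) grp] finite_subset[OF MG assms(3)] by simp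
  then show thesis
    using that M by (simp add: U_def)
qed

section \<open>Central sections in a supplemented group\<close>

lemma (in group) inv_mult_cancel:
  assumes "x \<in> carrier G" and "y \<in> carrier G"
  shows "inv x \<otimes> (x \<otimes> y) = y" and "x \<otimes> (inv x \<otimes> y) = y"
  using assms by (simp_all flip: m_assoc)

text \<open>Modulo \<open>S\<close>, conjugation by \<open>k m\<close> with \<open>k \<in> K\<close> is conjugation by \<open>m\<close>, because the inner
  conjugation by \<open>k\<close> fixes every coset of \<open>S\<close> in \<open>R\<close>. Hence all terms of the union coincide.\<close>

lemma section_conj_coset:
  fixes G (structure)
  assumes "group G" and "R \<lhd> G" and "S \<lhd> G" and "S \<subseteq> R" and "K \<lhd> G"
    and "K \<subseteq> section_centraliser G R S" and "r \<in> R" and "m \<in> carrier G"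
  shows "section_conj G S (S #> r) (K #> m) = S #> (inv m \<otimes> r \<otimes> m)"
proof -
  interpret group G by fact
  interpret q: group_hom G "G Mod S" "\<lambda>x. S #> x"
    using normal.factorgroup_is_group[OF assms(3)] normal.r_coset_hom_Mod[OF assms(3)]
    by (simp add: group_hom_def group_hom_axioms_def)
  have R: "subgroup R G" "R \<subseteq> carrier G" and S: "subgroup S G" "S \<subseteq> carrier G"
    and K: "subgroup K G" "K \<subseteq> carrier G"
    using assms(2,3,5) by (simp_all add: normal_imp_subgroup subgroup.subset)
  have left: "x <# S = S #> x" if "x \<in> carrier G" for x
    using normal.coset_eq[OF assms(3)] that by simp
  have conj: "(inv g \<otimes> r' \<otimes> g) <# S = S #> (inv m \<otimes> r \<otimes> m)"
    if r': "r' \<in> S #> r" and g: "g \<in> K #> m" for r' g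
  proof -
    obtain s where s: "s \<in> S" "r' = s \<otimes> r"
      using r' unfolding r_coset_def by blast
    obtain k where k: "k \<in> K" "g = k \<otimes> m"
      using g unfolding r_coset_def by blast
    have r'R: "r' \<in> R"
      using s assms(4,7) subgroup.m_closed[OF R(1)] by blast
    have c: "r' \<in> carrier G" "k \<in> carrier G" "r \<in> carrier G"
      using r'R k(1) R(2) K(2) assms(7) by blast+
    have "(inv k \<otimes> r' \<otimes> k) <# S = r' <# S"
      using k(1) r'R assms(6) unfolding section_centraliser_def by blast
    then have "S #> (inv k \<otimes> r' \<otimes> k) = S #> r'"
      using left c by simp
    also have "S #> r' = S #> r"
      using repr_independence[OF r' c(3) S(1)] by simp
    finally have eq: "S #> (inv k \<otimes> r' \<otimes> k) = S #> r" .
    have "inv g \<otimes> r' \<otimes> g = inv m \<otimes> (inv k \<otimes> r' \<otimes> k) \<otimes> m"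
      using c assms(8) k(2) by (simp add: inv_mult_group m_assoc)
    then have "S #> (inv g \<otimes> r' \<otimes> g) = S #> (inv m \<otimes> r \<otimes> m)"
      using q.hom_mult c assms(8) eq by simp
    moreover have "g \<in> carrier G"
      using k(2) c assms(8) by simp
    ultimately show ?thesis
      using left c by simp
  qed
  have "r \<in> S #> r" "m \<in> K #> m"
    using rcos_self S(1) K(1) assms(7,8) R(2) by blast+
  then have "{(inv g \<otimes> r' \<otimes> g) <# S | r' g. r' \<in> S #> r \<and> g \<in> K #> m} = {S #> (inv m \<otimes> r \<otimes> m)}"
    using conj by blast
  then show ?thesis
    by (simp add: section_conj_def)
qed

text \<open>The fibre product \<open>D\<close> of two copies of \<open>M\<close> over \<open>M/R\<close> is the semidirect product of \<open>R\<close> with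
  \<open>M\<close> in disguise: \<open>(m, n)\<close> corresponds to the normal component \<open>n m\<^sup>-\<^sup>1\<close> and the acting component
  \<open>m\<close>. Reducing these modulo \<open>S\<close> and \<open>K\<close> maps \<open>D\<close> onto \<open>[R/S](G/K)\<close>, and the two projections
  exhibit \<open>D\<close> as a subdirect product.\<close>

lemma section_semidirect_in_formation:
  fixes G (structure)
  assumes "formation \<FF>" and "group G" and "finite (carrier G)"
    and "subgroup M G" and "belongs_to (G\<lparr>carrier := M\<rparr>) \<FF>"
    and "R \<lhd> G" and "S \<lhd> G" and "S \<subseteq> R" and "R \<subseteq> M"
    and "K \<lhd> G" and "K \<subseteq> section_centraliser G R S" and "K <#> M = carrier G"
  shows "belongs_to (section_semidirect G R S K) \<FF>"
proof -
  interpret group G by fact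
  interpret GG: group "G \<times>\<times> G"
    by (rule DirProd_group[OF assms(2,2)])
  have R: "subgroup R G"
    using assms(6) by (rule normal_imp_subgroup)
  have MG: "M \<subseteq> carrier G"
    using assms(4) by (rule subgroup.subset)
  define Dc where "Dc = {(m, n). m \<in> M \<and> n \<in> M \<and> n \<otimes> inv m \<in> R}"
  define D where "D = (G \<times>\<times> G)\<lparr>carrier := Dc\<rparr>"
  have "subgroup Dc (G \<times>\<times> G)"
  proof (rule GG.subgroupI)
    show "Dc \<subseteq> carrier (G \<times>\<times> G)"
      using MG by (auto simp: Dc_def)
    have "(\<one>, \<one>) \<in> Dc"
      using subgroup.one_closed[OF assms(4)] subgroup.one_closed[OF R] by (simp add: Dc_def)
    then show "Dc \<noteq> {}"
      by blast
  next
    fix a assume "a \<in> Dc"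
    then obtain m n where a: "a = (m, n)" "m \<in> M" "n \<in> M" "n \<otimes> inv m \<in> R"
      by (auto simp: Dc_def)
    have c: "m \<in> carrier G" "n \<in> carrier G"
      using a MG by auto
    have "inv n \<otimes> inv (n \<otimes> inv m) \<otimes> n \<in> R"
      using normal.inv_op_closed1[OF assms(6) c(2)] subgroup.m_inv_closed[OF R] a(4) by blast
    moreover have "inv n \<otimes> inv (n \<otimes> inv m) \<otimes> n = inv n \<otimes> inv (inv m)"
      using c by (simp add: inv_mult_group m_assoc)
    ultimately show "inv\<^bsub>G \<times>\<times> G\<^esub> a \<in> Dc"
      using a c assms(2) subgroup.m_inv_closed[OF assms(4)] by (simp add: Dc_def)
  next
    fix a b assume "a \<in> Dc" "b \<in> Dc"
    then obtain m n m' n' where a: "a = (m, n)" "m \<in> M" "n \<in> M" "n \<otimes> inv m \<in> R"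
      and b: "b = (m', n')" "m' \<in> M" "n' \<in> M" "n' \<otimes> inv m' \<in> R"
      by (auto simp: Dc_def)
    have c: "m \<in> carrier G" "n \<in> carrier G" "m' \<in> carrier G" "n' \<in> carrier G"
      using a b MG by auto
    have "n \<otimes> (n' \<otimes> inv m') \<otimes> inv n \<otimes> (n \<otimes> inv m) \<in> R"
      using normal.inv_op_closed2[OF assms(6) c(2)] subgroup.m_closed[OF R] a(4) b(4) by blast
    moreover have "n \<otimes> (n' \<otimes> inv m') \<otimes> inv n \<otimes> (n \<otimes> inv m) = (n \<otimes> n') \<otimes> inv (m \<otimes> m')"
      using c by (simp add: inv_mult_group m_assoc inv_mult_cancel)
    ultimately show "a \<otimes>\<^bsub>G \<times>\<times> G\<^esub> b \<in> Dc"
      using a b subgroup.m_closed[OF assms(4)] by (simp add: Dc_def)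
  qed
  then have D: "group D"
    unfolding D_def by (rule GG.subgroup_imp_group)
  have finD: "finite (carrier D)"
    by (rule finite_subset[of _ "carrier G \<times> carrier G"])
      (use MG assms(3) in \<open>auto simp: D_def Dc_def\<close>)
  have diag: "(m, m) \<in> Dc" if "m \<in> M" for m
    using that MG subgroup.one_closed[OF R] by (auto simp: Dc_def r_inv)
  have p: "fst \<in> epi D (G\<lparr>carrier := M\<rparr>)" and q: "snd \<in> epi D (G\<lparr>carrier := M\<rparr>)"
    using diag by (force simp: epi_iff_subset hom_def D_def Dc_def)+
  have ker: "kernel D (G\<lparr>carrier := M\<rparr>) fst \<inter> kernel D (G\<lparr>carrier := M\<rparr>) snd \<subseteq> {\<one>\<^bsub>D\<^esub>}"
    by (auto simp: kernel_def D_def)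
  define X where "X = section_semidirect G R S K"
  define f where "f = (\<lambda>(m, n). (S #> (n \<otimes> inv m), K #> m))"
  have carX: "carrier X = (\<lambda>x. S #> x) ` R \<times> (\<lambda>x. K #> x) ` carrier G"
    by (simp add: X_def section_semidirect_def semidirect_def carrier_FactGroup)
  have multX: "(S #> x, K #> m) \<otimes>\<^bsub>X\<^esub> (S #> y, K #> m') = (S #> (x \<otimes> (m \<otimes> y \<otimes> inv m)), K #> (m \<otimes> m'))"
    if "x \<in> R" "y \<in> R" "m \<in> carrier G" "m' \<in> carrier G" for x y m m'
  proof -
    have c: "x \<in> carrier G" "y \<in> carrier G"
      using that subgroup.subset[OF R] by auto
    have "inv\<^bsub>G Mod K\<^esub> (K #> m) = K #> inv m"
      using that(3) normal.inv_FactGroup[OF assms(10)] normal.rcos_inv[OF assms(10)]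
      by (simp add: carrier_FactGroup)
    then have "section_conj G S (S #> y) (inv\<^bsub>G Mod K\<^esub> (K #> m)) = S #> (m \<otimes> y \<otimes> inv m)"
      using section_conj_coset[OF assms(2,6,7,8,10,11) that(2)] that(3) by simp
    then show ?thesis
      using that c normal.rcos_sum[OF assms(7)] normal.rcos_sum[OF assms(10)]
      by (simp add: X_def section_semidirect_def semidirect_def)
  qed
  have hom: "f \<in> hom D X"
  proof (rule homI)
    fix a assume "a \<in> carrier D"
    then show "f a \<in> carrier X"
      using MG by (auto simp: f_def carX D_def Dc_def)
  next
    fix a b assume "a \<in> carrier D" "b \<in> carrier D"
    then obtain m n m' n' where a: "a = (m, n)" "m \<in> M" "n \<in> M" "n \<otimes> inv m \<in> R"
      and b: "b = (m', n')" "m' \<in> M" "n' \<in> M" "n' \<otimes> inv m' \<in> R"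
      by (auto simp: D_def Dc_def)
    have c: "m \<in> carrier G" "n \<in> carrier G" "m' \<in> carrier G" "n' \<in> carrier G"
      using a b MG by auto
    have "n \<otimes> inv m \<otimes> (m \<otimes> (n' \<otimes> inv m') \<otimes> inv m) = n \<otimes> n' \<otimes> inv (m \<otimes> m')"
      using c by (simp add: inv_mult_group m_assoc inv_mult_cancel)
    then show "f (a \<otimes>\<^bsub>D\<^esub> b) = f a \<otimes>\<^bsub>X\<^esub> f b"
      using multX[OF a(4) b(4) c(1,3)] a(1) b(1) by (simp add: f_def D_def)
  qed
  have onto: "carrier X \<subseteq> f ` carrier D"
  proof
    fix z assume "z \<in> carrier X"
    then obtain r g where z: "z = (S #> r, K #> g)" "r \<in> R" "g \<in> carrier G"
      by (auto simp: carX)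
    obtain m where m: "m \<in> M" "K #> g = K #> m"
      using supplement_coset_representative[OF assms(10,4,12) z(3)] by blast
    have c: "r \<in> carrier G" "m \<in> carrier G"
      using z(2) m(1) MG assms(9) by auto
    have rm: "r \<otimes> m \<otimes> inv m = r"
      using c by (simp add: m_assoc)
    have "(m, r \<otimes> m) \<in> carrier D"
      using m(1) z(2) rm assms(9) subgroup.m_closed[OF assms(4)] by (auto simp: D_def Dc_def)
    moreover have "f (m, r \<otimes> m) = z"
      using rm z(1) m(2) by (simp add: f_def)
    ultimately show "z \<in> f ` carrier D"
      by blast
  qed
  have epi: "f \<in> epi D X"
    using hom onto by (simp add: epi_iff_subset)
  \<comment> \<open>The group axioms of the semidirect product are inherited from \<open>D\<close>.\<close>
  have "f \<one>\<^bsub>D\<^esub> = \<one>\<^bsub>X\<^esub>"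
    using subgroup.subset[OF normal_imp_subgroup[OF assms(7)]]
      subgroup.subset[OF normal_imp_subgroup[OF assms(10)]]
    by (simp add: f_def D_def X_def section_semidirect_def semidirect_def)
  then have "X\<lparr>carrier := f ` carrier D, one := f \<one>\<^bsub>D\<^esub>\<rparr> = X"
    using epi by (simp add: epi_def)
  then have "group X"
    using group.hom_imp_img_group[OF D hom] by simp
  then show ?thesis
    using formation_subdirect_image[OF assms(1) D finD p assms(5) q assms(5) ker _ epi]
    by (simp add: X_def)
qed

section \<open>The centraliser of a normal subgroup in a supplement\<close>

definition centraliser_in :: "('a, 'b) monoid_scheme \<Rightarrow> 'a set \<Rightarrow> 'a set \<Rightarrow> 'a set" where
  "centraliser_in G M N = {m \<in> M. \<forall>x\<in>N. m \<otimes>\<^bsub>G\<^esub> x = x \<otimes>\<^bsub>G\<^esub> m}"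

lemma (in group) subgroup_centraliser_in:
  assumes "subgroup M G" and "N \<subseteq> carrier G"
  shows "subgroup (centraliser_in G M N) G"
proof (rule subgroupI)
  have MG: "M \<subseteq> carrier G"
    using assms(1) by (rule subgroup.subset)
  then show "centraliser_in G M N \<subseteq> carrier G"
    by (auto simp: centraliser_in_def)
  have "\<one> \<in> centraliser_in G M N"
    using subgroup.one_closed[OF assms(1)] assms(2) by (auto simp: centraliser_in_def)
  then show "centraliser_in G M N \<noteq> {}"
    by blast
  show "inv a \<in> centraliser_in G M N" if a: "a \<in> centraliser_in G M N" for a
  proof -
    have aM: "a \<in> M" "a \<in> carrier G"
      using a MG by (auto simp: centraliser_in_def)
    have "inv a \<otimes> x = x \<otimes> inv a" if x: "x \<in> N" for x
    proof -
      have xG: "x \<in> carrier G"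
        using x assms(2) by auto
      have "inv a \<otimes> x = inv a \<otimes> (x \<otimes> a) \<otimes> inv a"
        using xG aM by (simp add: m_assoc)
      also have "x \<otimes> a = a \<otimes> x"
        using a x by (simp add: centraliser_in_def)
      also have "inv a \<otimes> (a \<otimes> x) \<otimes> inv a = x \<otimes> inv a"
        using xG aM by (simp add: inv_mult_cancel)
      finally show ?thesis .
    qed
    then show ?thesis
      using aM subgroup.m_inv_closed[OF assms(1)] by (simp add: centraliser_in_def)
  qed
  show "a \<otimes> b \<in> centraliser_in G M N"
    if a: "a \<in> centraliser_in G M N" and b: "b \<in> centraliser_in G M N" for a b
  proof -
    have c: "a \<in> M" "b \<in> M" "a \<in> carrier G" "b \<in> carrier G"
      using a b MG by (auto simp: centraliser_in_def)
    have "a \<otimes> b \<otimes> x = x \<otimes> (a \<otimes> b)" if x: "x \<in> N" for x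
    proof -
      have xG: "x \<in> carrier G"
        using x assms(2) by auto
      have "a \<otimes> b \<otimes> x = a \<otimes> (b \<otimes> x)"
        using c xG by (simp add: m_assoc)
      also have "b \<otimes> x = x \<otimes> b"
        using b x by (simp add: centraliser_in_def)
      also have "a \<otimes> (x \<otimes> b) = a \<otimes> x \<otimes> b"
        using c xG by (simp add: m_assoc)
      also have "a \<otimes> x = x \<otimes> a"
        using a x by (simp add: centraliser_in_def)
      also have "x \<otimes> a \<otimes> b = x \<otimes> (a \<otimes> b)"
        using c xG by (simp add: m_assoc)
      finally show ?thesis .
    qed
    then show ?thesis
      using c subgroup.m_closed[OF assms(1)] by (simp add: centraliser_in_def)
  qed
qed

text \<open>Conjugation by \<open>M\<close> preserves both \<open>M\<close> and \<open>N\<close>, and conjugation by \<open>N\<close> is trivial on the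
  centraliser; together these exhaust \<open>G = N M\<close>.\<close>

lemma (in group) normal_centraliser_in_supplement:
  assumes "N \<lhd> G" and "subgroup M G" and "N <#> M = carrier G"
  shows "centraliser_in G M N \<lhd> G"
proof (rule normal_invI)
  have NG: "N \<subseteq> carrier G" and MG: "M \<subseteq> carrier G"
    using assms(1,2) by (simp_all add: normal_imp_subgroup subgroup.subset)
  show "subgroup (centraliser_in G M N) G"
    using subgroup_centraliser_in[OF assms(2) NG] .
  fix g c assume g: "g \<in> carrier G" and c: "c \<in> centraliser_in G M N"
  obtain v m where vm: "v \<in> N" "m \<in> M" "g = v \<otimes> m"
    using g assms(3) unfolding set_mult_def by blast
  have cM: "c \<in> M"
    using c by (simp add: centraliser_in_def)
  have [simp]: "v \<in> carrier G" "m \<in> carrier G" "c \<in> carrier G"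
    using vm cM NG MG by auto
  define d where "d = m \<otimes> c \<otimes> inv m"
  have dM: "d \<in> M"
    using vm(2) cM assms(2) by (simp add: d_def subgroup.m_closed subgroup.m_inv_closed)
  have [simp]: "d \<in> carrier G"
    using dM MG by auto
  have comm: "d \<otimes> x = x \<otimes> d" if x: "x \<in> N" for x
  proof -
    define y where "y = inv m \<otimes> x \<otimes> m"
    have y: "y \<in> N"
      using normal.inv_op_closed1[OF assms(1)] x by (simp add: y_def)
    have [simp]: "x \<in> carrier G" "y \<in> carrier G"
      using x y NG by auto
    have x_eq: "x = m \<otimes> y \<otimes> inv m"
      by (simp add: y_def m_assoc inv_mult_cancel)
    have "d \<otimes> x = m \<otimes> (c \<otimes> y) \<otimes> inv m"
      unfolding x_eq d_def by (simp add: m_assoc inv_mult_cancel)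
    also have "c \<otimes> y = y \<otimes> c"
      using c y by (simp add: centraliser_in_def)
    also have "m \<otimes> (y \<otimes> c) \<otimes> inv m = x \<otimes> d"
      unfolding x_eq d_def by (simp add: m_assoc inv_mult_cancel)
    finally show ?thesis .
  qed
  have "g \<otimes> c \<otimes> inv g = v \<otimes> d \<otimes> inv v"
    by (simp add: vm(3) d_def m_assoc inv_mult_group)
  also have "\<dots> = d"
    using comm[OF vm(1)] by (metis \<open>d \<in> carrier G\<close> \<open>v \<in> carrier G\<close> inv_solve_right' m_closed)
  finally show "g \<otimes> c \<otimes> inv g \<in> centraliser_in G M N"
    using dM comm by (simp add: centraliser_in_def)
qed

lemma (in group) conjugation_in_auto:
  assumes "N \<lhd> G" and "g \<in> carrier G"
  shows "(\<lambda>x\<in>N. g \<otimes> x \<otimes> inv g) \<in> auto (G\<lparr>carrier := N\<rparr>)"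
proof -
  have NG: "N \<subseteq> carrier G"
    using assms(1) by (simp add: normal_imp_subgroup subgroup.subset)
  have cl: "g \<otimes> x \<otimes> inv g \<in> N" "inv g \<otimes> x \<otimes> g \<in> N" if "x \<in> N" for x
    using normal.inv_op_closed1[OF assms(1)] normal.inv_op_closed2[OF assms(1)] assms(2) that
    by blast+
  have N: "x \<otimes> y \<in> N" if "x \<in> N" "y \<in> N" for x y
    using that subgroup.m_closed[OF normal_imp_subgroup[OF assms(1)]] by blast
  have "(\<lambda>x\<in>N. g \<otimes> x \<otimes> inv g) \<in> hom (G\<lparr>carrier := N\<rparr>) (G\<lparr>carrier := N\<rparr>)"
  proof (rule homI)
    show "(\<lambda>x\<in>N. g \<otimes> x \<otimes> inv g) x \<in> carrier (G\<lparr>carrier := N\<rparr>)"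
      if "x \<in> carrier (G\<lparr>carrier := N\<rparr>)" for x
      using that cl by simp
    fix x y assume "x \<in> carrier (G\<lparr>carrier := N\<rparr>)" "y \<in> carrier (G\<lparr>carrier := N\<rparr>)"
    then have xy: "x \<in> N" "y \<in> N" "x \<in> carrier G" "y \<in> carrier G"
      using NG by auto
    have "g \<otimes> (x \<otimes> y) \<otimes> inv g = (g \<otimes> x \<otimes> inv g) \<otimes> (g \<otimes> y \<otimes> inv g)"
      using xy assms(2) by (simp add: m_assoc inv_mult_cancel)
    then show "(\<lambda>x\<in>N. g \<otimes> x \<otimes> inv g) (x \<otimes>\<^bsub>G\<lparr>carrier := N\<rparr>\<^esub> y) =
        (\<lambda>x\<in>N. g \<otimes> x \<otimes> inv g) x \<otimes>\<^bsub>G\<lparr>carrier := N\<rparr>\<^esub> (\<lambda>x\<in>N. g \<otimes> x \<otimes> inv g) y"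
      using xy N by simp
  qed
  moreover have "bij_betw (\<lambda>x\<in>N. g \<otimes> x \<otimes> inv g) N N"
  proof (rule bij_betw_byWitness[where f' = "\<lambda>x. inv g \<otimes> x \<otimes> g"])
    show "\<forall>x\<in>N. inv g \<otimes> (\<lambda>x\<in>N. g \<otimes> x \<otimes> inv g) x \<otimes> g = x"
    proof
      fix x assume "x \<in> N"
      then show "inv g \<otimes> (\<lambda>x\<in>N. g \<otimes> x \<otimes> inv g) x \<otimes> g = x"
        using NG assms(2) by (auto simp: subset_iff m_assoc inv_mult_cancel)
    qed
    show "\<forall>x\<in>N. (\<lambda>x\<in>N. g \<otimes> x \<otimes> inv g) (inv g \<otimes> x \<otimes> g) = x"
    proof
      fix x assume "x \<in> N"
      then show "(\<lambda>x\<in>N. g \<otimes> x \<otimes> inv g) (inv g \<otimes> x \<otimes> g) = x"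
        using NG assms(2) cl(2)[of x] by (auto simp: subset_iff m_assoc inv_mult_cancel)
    qed
    show "(\<lambda>x\<in>N. g \<otimes> x \<otimes> inv g) ` N \<subseteq> N" "(\<lambda>x. inv g \<otimes> x \<otimes> g) ` N \<subseteq> N"
      using cl by auto
  qed
  ultimately show ?thesis
    by (simp add: auto_def Bij_def)
qed

lemma finite_auto:
  assumes "finite (carrier G)"
  shows "finite (auto G)"
proof (rule finite_subset)
  show "auto G \<subseteq> carrier G \<rightarrow>\<^sub>E carrier G"
    by (auto simp: auto_def Bij_def PiE_def hom_def)
  show "finite (carrier G \<rightarrow>\<^sub>E carrier G)"
    using assms by (simp add: finite_PiE)
qed

text \<open>The centraliser is the kernel of the conjugation action.\<close>

lemma (in group) card_le_centraliser_in_times_auto: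
  assumes "finite (carrier G)" and "N \<lhd> G" and "subgroup M G"
  shows "card M \<le> card (centraliser_in G M N) * card (auto (G\<lparr>carrier := N\<rparr>))"
proof -
  let ?M = "G\<lparr>carrier := M\<rparr>" and ?A = "AutoGroup (G\<lparr>carrier := N\<rparr>)"
  have NG: "N \<subseteq> carrier G" and MG: "M \<subseteq> carrier G"
    using assms(2,3) by (simp_all add: normal_imp_subgroup subgroup.subset)
  interpret M: group ?M
    using assms(3) by (rule subgroup_imp_group)
  interpret A: group ?A
    using group.AutoGroup subgroup_imp_group normal_imp_subgroup[OF assms(2)] by blast
  define c where "c = (\<lambda>g. \<lambda>x\<in>N. g \<otimes> x \<otimes> inv g)"
  have carA: "carrier ?A = auto (G\<lparr>carrier := N\<rparr>)"
    by (simp add: AutoGroup_def)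
  have cB: "c g \<in> Bij N" "c g \<in> auto (G\<lparr>carrier := N\<rparr>)" if "g \<in> carrier G" for g
    using conjugation_in_auto[OF assms(2) that] by (simp_all add: c_def auto_def)
  have "c \<in> hom ?M ?A"
  proof (rule homI)
    show "c g \<in> carrier ?A" if "g \<in> carrier ?M" for g
      using that cB MG carA by auto
    fix g h assume "g \<in> carrier ?M" "h \<in> carrier ?M"
    then have gh: "g \<in> carrier G" "h \<in> carrier G"
      using MG by auto
    have "c (g \<otimes> h) x = compose N (c g) (c h) x" for x
    proof (cases "x \<in> N")
      case True
      then have x: "x \<in> carrier G" "h \<otimes> x \<otimes> inv h \<in> N"
        using NG normal.inv_op_closed2[OF assms(2)] gh by auto
      then show ?thesis
        using True gh by (simp add: c_def compose_def inv_mult_group m_assoc)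
    qed (simp add: c_def compose_def)
    then show "c (g \<otimes>\<^bsub>?M\<^esub> h) = c g \<otimes>\<^bsub>?A\<^esub> c h"
      using cB gh by (simp add: AutoGroup_def BijGroup_def fun_eq_iff)
  qed
  then interpret c: group_hom ?M ?A c
    by unfold_locales
  have fixes_iff: "g \<otimes> x \<otimes> inv g = x \<longleftrightarrow> g \<otimes> x = x \<otimes> g" if "g \<in> carrier G" "x \<in> carrier G" for g x
    using that inv_solve_right' by auto
  have "c g = \<one>\<^bsub>?A\<^esub> \<longleftrightarrow> (\<forall>x\<in>N. g \<otimes> x = x \<otimes> g)" if "g \<in> M" for g
  proof -
    have "c g = \<one>\<^bsub>?A\<^esub> \<longleftrightarrow> (\<forall>x\<in>N. g \<otimes> x \<otimes> inv g = x)"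
      by (auto simp: c_def AutoGroup_def BijGroup_def fun_eq_iff)
    then show ?thesis
      using fixes_iff that MG NG by (metis subsetD)
  qed
  then have ker: "kernel ?M ?A c = centraliser_in G M N"
    by (auto simp: kernel_def centraliser_in_def)
  have "card (carrier (?M Mod kernel ?M ?A c)) \<le> card (auto (G\<lparr>carrier := N\<rparr>))"
  proof (rule card_inj_on_le[OF c.FactGroup_inj_on])
    show "(\<lambda>X. the_elem (c ` X)) ` carrier (?M Mod kernel ?M ?A c) \<subseteq> auto (G\<lparr>carrier := N\<rparr>)"
      using c.FactGroup_the_elem_mem carA by blast
    show "finite (auto (G\<lparr>carrier := N\<rparr>))"
      using finite_auto[of "G\<lparr>carrier := N\<rparr>"] finite_subset[OF NG assms(1)] by simp
  qed
  then have "card (rcosets\<^bsub>?M\<^esub> centraliser_in G M N) \<le> card (auto (G\<lparr>carrier := N\<rparr>))"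
    by (simp add: ker FactGroup_def)
  moreover have "card (rcosets\<^bsub>?M\<^esub> centraliser_in G M N) * card (centraliser_in G M N) = card M"
    using M.lagrange c.subgroup_kernel by (simp add: ker order_def)
  ultimately show ?thesis
    by (metis mult.commute mult_le_mono1)
qed

section \<open>The bound on the index of the hypercentre\<close>

lemma order_Hol: "order (Hol G) = card (carrier G) * card (auto G)"
  by (simp add: order_def Hol_def semidirect_def AutoGroup_def card_cartesian_product)

lemma subgroup_hypercentre:
  assumes "group G"
  shows "subgroup (hypercentre \<FF> G) G"
  unfolding hypercentre_def
proof (rule group.generate_is_subgroup[OF assms], rule Union_least)
  fix N assume "N \<in> {N. N \<lhd> G \<and> (N = {\<one>\<^bsub>G\<^esub>} \<or>
    N \<noteq> {\<one>\<^bsub>G\<^esub>} \<and> (\<forall>R S. chief_factor G R S \<and> R \<subseteq> N \<longrightarrow> central_section \<FF> G R S))}"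
  then show "N \<subseteq> carrier G"
    by (simp add: normal_imp_subgroup subgroup.subset)
qed

lemma central_sections_imp_subset_hypercentre:
  assumes "N \<lhd> G" and "\<And>R S. chief_factor G R S \<Longrightarrow> R \<subseteq> N \<Longrightarrow> central_section \<FF> G R S"
  shows "N \<subseteq> hypercentre \<FF> G"
  using assms unfolding hypercentre_def by (blast intro: generate.incl)

text \<open>As \<open>N\<close> centralises every section below \<open>C\<^sub>M(N)\<close>, the semidirect products with \<open>G/N\<close> witness
  centrality.\<close>

lemma centraliser_in_subset_hypercentre:
  fixes G (structure)
  assumes "formation \<FF>" and "group G" and "finite (carrier G)"
    and "N \<lhd> G" and "subgroup M G" and "N <#> M = carrier G"
    and "belongs_to (G\<lparr>carrier := M\<rparr>) \<FF>"
  shows "centraliser_in G M N \<subseteq> hypercentre \<FF> G"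
proof (rule central_sections_imp_subset_hypercentre)
  interpret group G by fact
  show "centraliser_in G M N \<lhd> G"
    using normal_centraliser_in_supplement[OF assms(4-6)] .
  have NG: "N \<subseteq> carrier G"
    using assms(4) by (simp add: normal_imp_subgroup subgroup.subset)
  fix R S assume chief: "chief_factor G R S" and RC: "R \<subseteq> centraliser_in G M N"
  then have RS: "R \<lhd> G" "S \<lhd> G" "S \<subseteq> R"
    by (auto simp: chief_factor_def)
  have RG: "R \<subseteq> carrier G"
    using RS(1) by (simp add: normal_imp_subgroup subgroup.subset)
  have RM: "R \<subseteq> M"
    using RC by (auto simp: centraliser_in_def)
  have "inv u \<otimes> r \<otimes> u = r" if "u \<in> N" "r \<in> R" for u r
  proof -
    have c: "u \<in> carrier G" "r \<in> carrier G"
      using that NG RG by auto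
    have "r \<otimes> u = u \<otimes> r"
      using that RC by (auto simp: centraliser_in_def)
    then show ?thesis
      using c by (simp add: m_assoc inv_mult_cancel)
  qed
  then have "N \<subseteq> section_centraliser G R S"
    using NG by (auto simp: section_centraliser_def)
  then show "central_section \<FF> G R S"
    unfolding central_section_def
    using section_semidirect_in_formation[OF assms(1-3,5,7) RS RM assms(4) _ assms(6)] assms(4)
    by blast
qed

theorem corollary1p2:
  fixes \<FF> :: "nat monoid set"
    and G :: "('a, 'b) monoid_scheme"
    and U :: "'a set"
  assumes "saturated_formation \<FF>"
    and "group G"
    and "finite (carrier G)"
    and "U = residual \<FF> G"
    and "U \<inter> hypercentre \<FF> G = {\<one>\<^bsub>G\<^esub>}"
  shows "order (G Mod hypercentre \<FF> G) \<le> order (Hol (G\<lparr>carrier := U\<rparr>))"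
proof -
  interpret group G by fact
  define Z where "Z = hypercentre \<FF> G"
  have form: "formation \<FF>"
    using assms(1) by (simp add: saturated_formation_def)
  have U: "U \<lhd> G" and UG: "U \<subseteq> carrier G"
    using residual_normal[OF assms(2)] assms(4) by (auto simp: residual_def)
  obtain M where M: "subgroup M G" "U <#>\<^bsub>G\<^esub> M = carrier G" "belongs_to (G\<lparr>carrier := M\<rparr>) \<FF>"
    using residual_supplement[OF assms(1-3)] assms(4) by blast
  have MG: "M \<subseteq> carrier G"
    using M(1) by (rule subgroup.subset)
  define C where "C = centraliser_in G M U"
  have CZ: "C \<subseteq> Z"
    unfolding C_def Z_def
    using centraliser_in_subset_hypercentre[OF form assms(2,3) U M] .
  have Z: "subgroup Z G"
    unfolding Z_def using subgroup_hypercentre[OF assms(2)] .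
  have finZ: "finite Z"
    using subgroup.subset[OF Z] assms(3) finite_subset by blast
  have "subgroup C G"
    unfolding C_def using subgroup_centraliser_in[OF M(1) UG] .
  then have C_pos: "0 < card C"
    using assms(3) by (rule subgroup.finite_imp_card_positive)
  have "carrier G = (\<lambda>(u, m). u \<otimes>\<^bsub>G\<^esub> m) ` (U \<times> M)"
    unfolding M(2)[symmetric] set_mult_def by auto
  moreover have "finite (U \<times> M)"
    using finite_subset[OF UG assms(3)] finite_subset[OF MG assms(3)] by simp
  ultimately have "order G \<le> card (U \<times> M)"
    unfolding order_def by (metis card_image_le)
  then have "order G \<le> card U * card M"
    by (simp add: card_cartesian_product)
  also have "\<dots> \<le> card U * (card C * card (auto (G\<lparr>carrier := U\<rparr>)))"
    unfolding C_def using card_le_centraliser_in_times_auto[OF assms(3) U M(1)] by simp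
  also have "\<dots> = card C * order (Hol (G\<lparr>carrier := U\<rparr>))"
    by (simp add: order_Hol)
  finally have "order G \<le> card C * order (Hol (G\<lparr>carrier := U\<rparr>))" .
  moreover have "card C * order (G Mod Z) \<le> order G"
  proof -
    have "card C * order (G Mod Z) \<le> card Z * order (G Mod Z)"
      using card_mono[OF finZ CZ] by simp
    also have "\<dots> = order G"
      using lagrange[OF Z] by (simp add: order_def FactGroup_def mult.commute)
    finally show ?thesis .
  qed
  ultimately show ?thesis
    using C_pos by (metis Z_def mult_le_cancel1 order_trans)
qed

end
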